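(* Let $\lambda>0$, $\gamma\ge 0$, and let $\mathcal H(\gamma,\lambda)$ be the six-dimensional ModMax–Born–Infeld chiral two-form Hamiltonian density $$\mathcal H(s,p;\gamma,\lambda)=\frac1\lambda\left(\sqrt{1+2\lambda\left(s\cosh\gamma-\sinh\gamma\,\sqrt{s^2-p^2}\right)+\lambda^2p^2}-1\right),$$ where $s,p$ are the invariants (defined in the context) of a real antisymmetric $5\times5$ matrix $B_{ij}$. Let $T_{\mu\nu}$ be the energy-momentum tensor associated with $\mathcal H(\gamma,\lambda)$ (at the same values of $\gamma,\lambda$) and put $$\mathcal O_{T^2}=\frac1{12}\left(T^{\mu\nu}T_{\mu\nu}-\frac13\left(T^\mu{}_\mu\right)^2\right),\qquad \mathcal R=\sqrt{\frac16\left(T^{\mu\nu}T_{\mu\nu}-\frac16\left(T^\mu{}_\mu\right)^2\right)} .$$ Then, at all points with $s>p>0$ at which $\partial_s\mathcal H\ge 0$, $$\frac{\partial\mathcal H}{\partial\lambda}=-\mathcal O_{T^2},\qquad \frac{\partial\mathcal H}{\partial\gamma}=-\mathcal R .$$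
   Context: For a real antisymmetric $5\times 5$ matrix $B_{ij}$ ($i,j=1,\dots,5$, indices raised and lowered with $\delta_{ij}$) set $s=\frac14 B_{ij}B_{ij}$, $p_i=\frac18\varepsilon_{ijklm}B_{jk}B_{lm}$, $p=\sqrt{p_ip_i}$. One always has $s\ge p\ge 0$. A function $\mathcal H(s,p)$ is regarded as a function of $B$; the antisymmetric matrix $H_{ij}$ is defined by $\delta\mathcal H=\frac12 H_{ij}\,\delta B_{ij}$ (sum over all $i,j$) for antisymmetric variations $\delta B$. The energy-momentum tensor $T_{\mu\nu}$ ($\mu,\nu=0,\dots,5$) associated with $\mathcal H$ is the symmetric tensor with $$T_{00}=\mathcal H,\qquad T_{0i}=-p_i,\qquad T_{ij}=-\delta_{ij}\left(\mathcal H-\tfrac12 H_{kl}B_{kl}\right)-H_{ik}B_{jk}.$$ Space-time indices are raised with $\eta=\mathrm{diag}(-1,1,1,1,1,1)$. *)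

theory Defs
  imports "HOL-Analysis.Analysis"
begin

(* Spatial indices live in the numeral type 5, whose elements are 1, 2, 3, 4 and 5 = 0. *)

type_synonym mat5 = "real ^ 5 ^ 5"

definition antisym_mats :: "mat5 set" where
  "antisym_mats = {B. \<forall>i j. B $ i $ j = - B $ j $ i}"

(* Normalised by levi_civita 1 2 3 4 5 = 1.  The guard is needed because sign is
   meaningful only for permutations. *)
definition levi_civita :: "5 \<Rightarrow> 5 \<Rightarrow> 5 \<Rightarrow> 5 \<Rightarrow> 5 \<Rightarrow> real" where
  "levi_civita i j k l m =
     (let \<pi> = (\<lambda>x::5. if x = 1 then i else if x = 2 then j else if x = 3 then k
                       else if x = 4 then l else m)
      in if bij \<pi> then of_int (sign \<pi>) else 0)"

definition s_inv :: "mat5 \<Rightarrow> real" where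
  "s_inv B = 1/4 * (\<Sum>i\<in>UNIV. \<Sum>j\<in>UNIV. B $ i $ j * B $ i $ j)"

definition p_vec :: "mat5 \<Rightarrow> real ^ 5" where
  "p_vec B = (\<chi> i. 1/8 * (\<Sum>j\<in>UNIV. \<Sum>k\<in>UNIV. \<Sum>l\<in>UNIV. \<Sum>m\<in>UNIV.
      levi_civita i j k l m * B $ j $ k * B $ l $ m))"

definition p_inv :: "mat5 \<Rightarrow> real" where
  "p_inv B = sqrt (\<Sum>i\<in>UNIV. p_vec B $ i * p_vec B $ i)"

(* The antisymmetric matrix H with dh = 1/2 H_ij dB_ij for antisymmetric variations dB:
   the derivative is taken within the space of antisymmetric matrices.  Meaningful
   wherever h (s, p) is differentiable as a function of B; H is then unique. *)
definition conj_field :: "(real \<Rightarrow> real \<Rightarrow> real) \<Rightarrow> mat5 \<Rightarrow> mat5" where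
  "conj_field h B = (THE H. H \<in> antisym_mats \<and>
     ((\<lambda>X. h (s_inv X) (p_inv X)) has_derivative
      (\<lambda>dB. 1/2 * (\<Sum>i\<in>UNIV. \<Sum>j\<in>UNIV. H $ i $ j * dB $ i $ j)))
       (at B within antisym_mats))"

(* Space-time indices: None is the time index 0, Some i is the spatial index i. *)
type_synonym idx6 = "5 option"

definition minkowski :: "idx6 \<Rightarrow> idx6 \<Rightarrow> real" where
  "minkowski \<mu> \<nu> = (if \<mu> = \<nu> then (if \<mu> = None then -1 else 1) else 0)"

(* Lower-index components T_mu_nu. *)
definition em_tensor :: "(real \<Rightarrow> real \<Rightarrow> real) \<Rightarrow> mat5 \<Rightarrow> idx6 \<Rightarrow> idx6 \<Rightarrow> real" where
  "em_tensor h B \<mu> \<nu> =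
     (let h0 = h (s_inv B) (p_inv B); H = conj_field h B in
      case \<mu> of
        None \<Rightarrow> (case \<nu> of None \<Rightarrow> h0 | Some j \<Rightarrow> - p_vec B $ j)
      | Some i \<Rightarrow> (case \<nu> of
            None \<Rightarrow> - p_vec B $ i
          | Some j \<Rightarrow>
              - (if i = j then 1 else 0)
                  * (h0 - 1/2 * (\<Sum>k\<in>UNIV. \<Sum>l\<in>UNIV. H $ k $ l * B $ k $ l))
              - (\<Sum>k\<in>UNIV. H $ i $ k * B $ j $ k)))"

definition raise2 :: "(idx6 \<Rightarrow> idx6 \<Rightarrow> real) \<Rightarrow> idx6 \<Rightarrow> idx6 \<Rightarrow> real" where
  "raise2 T \<mu> \<nu> = (\<Sum>\<alpha>\<in>UNIV. \<Sum>\<beta>\<in>UNIV. minkowski \<mu> \<alpha> * minkowski \<nu> \<beta> * T \<alpha> \<beta>)"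

definition tensor_square :: "(idx6 \<Rightarrow> idx6 \<Rightarrow> real) \<Rightarrow> real" where
  "tensor_square T = (\<Sum>\<mu>\<in>UNIV. \<Sum>\<nu>\<in>UNIV. raise2 T \<mu> \<nu> * T \<mu> \<nu>)"

definition tensor_trace :: "(idx6 \<Rightarrow> idx6 \<Rightarrow> real) \<Rightarrow> real" where
  "tensor_trace T = (\<Sum>\<mu>\<in>UNIV. \<Sum>\<nu>\<in>UNIV. minkowski \<mu> \<nu> * T \<nu> \<mu>)"

definition O_T2 :: "(idx6 \<Rightarrow> idx6 \<Rightarrow> real) \<Rightarrow> real" where
  "O_T2 T = 1/12 * (tensor_square T - 1/3 * (tensor_trace T)\<^sup>2)"

definition R_op :: "(idx6 \<Rightarrow> idx6 \<Rightarrow> real) \<Rightarrow> real" where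
  "R_op T = sqrt (1/6 * (tensor_square T - 1/6 * (tensor_trace T)\<^sup>2))"

definition mmbi :: "real \<Rightarrow> real \<Rightarrow> real \<Rightarrow> real \<Rightarrow> real" where
  "mmbi \<gamma> lam s p = 1 / lam *
     (sqrt (1 + 2 * lam * (s * cosh \<gamma> - sinh \<gamma> * sqrt (s\<^sup>2 - p\<^sup>2)) + lam\<^sup>2 * p\<^sup>2) - 1)"

end

theory Submission
  imports Defs
begin

text \<open>Write \<open>M = B B\<^sup>T\<close> and \<open>G\<^sub>l\<^sub>m = \<epsilon>\<^sub>i\<^sub>j\<^sub>k\<^sub>l\<^sub>m p\<^sub>i B\<^sub>j\<^sub>k / 2\<close>. Then \<open>ds = B \<cdot> dB / 2\<close> and
  \<open>p dp = G \<cdot> dB / 2\<close>, so \<open>H = h\<^sub>s B + (h\<^sub>p / p) G\<close> for every Hamiltonian \<open>h(s, p)\<close>. The polynomial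
  identities \<open>G B\<^sup>T = p\<^sup>2 I - p p\<^sup>T\<close>, \<open>B p = 0\<close>, \<open>tr M = 4 s\<close> and \<open>tr M\<^sup>2 = 8 s\<^sup>2 - 4 p\<^sup>2\<close> give, without
  bringing \<open>B\<close> to block form, with \<open>x = s h\<^sub>s + p h\<^sub>p\<close> and \<open>y\<^sup>2 = (s\<^sup>2 - p\<^sup>2) h\<^sub>s\<^sup>2\<close>,
  \<open>tr T = 6 (x - h)\<close> and \<open>T \<cdot> T = 6 h\<^sup>2 - 12 h x + 8 x\<^sup>2 - 2 p\<^sup>2 + 4 y\<^sup>2\<close>.
  For the ModMax-Born-Infeld Hamiltonian \<open>y\<^sup>2 = x\<^sup>2 - p\<^sup>2\<close>, hence \<open>R = \<bar>y\<bar>\<close> and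
  \<open>O = - (h\<^sup>2 - 2 h x + p\<^sup>2) / 2\<close>; the sign condition on \<open>h\<^sub>s\<close> selects \<open>R = y\<close>.\<close>

section \<open>Enumeration of the five spatial indices\<close>

lemma exhaust_5:
  fixes x :: 5
  shows "x = 1 \<or> x = 2 \<or> x = 3 \<or> x = 4 \<or> x = 5"
proof (induct x)
  case (of_int z)
  then have "0 \<le> z" and "z < 5" by simp_all
  then have "z = 0 \<or> z = 1 \<or> z = 2 \<or> z = 3 \<or> z = 4" by arith
  \<comment> \<open>The representative \<open>z = 0\<close> is the numeral 5.\<close>
  then show ?case by auto
qed

lemma forall_5: "(\<forall>i::5. P i) \<longleftrightarrow> P 1 \<and> P 2 \<and> P 3 \<and> P 4 \<and> P 5"
  by (metis exhaust_5)

lemma UNIV_5: "(UNIV :: 5 set) = {1, 2, 3, 4, 5}"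
  using exhaust_5 by auto

lemma sum_5: "sum f (UNIV :: 5 set) = f 1 + f 2 + f 3 + f 4 + f 5"
  unfolding UNIV_5 by (simp add: ac_simps)

section \<open>The Levi-Civita symbol\<close>

text \<open>Naming the map inside \<open>levi_civita\<close> turns an exchange of arguments into
  composition with a transposition. The last branch is the index 5.\<close>

definition idx_map :: "5 \<Rightarrow> 5 \<Rightarrow> 5 \<Rightarrow> 5 \<Rightarrow> 5 \<Rightarrow> 5 \<Rightarrow> 5" where
  "idx_map i j k l m = (\<lambda>x. if x = 1 then i else if x = 2 then j else if x = 3 then k
                       else if x = 4 then l else m)"

lemma levi_civita_idx_map:
  "levi_civita i j k l m =
     (if bij (idx_map i j k l m) then of_int (sign (idx_map i j k l m)) else 0)"
  by (simp add: levi_civita_def idx_map_def Let_def)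

text \<open>Composing with a transposition preserves bijectivity in both directions and flips the
  sign, so both branches of the guard are covered.\<close>

lemma levi_civita_transpose:
  assumes "idx_map i' j' k' l' m' = idx_map i j k l m \<circ> Transposition.transpose a b" and "a \<noteq> b"
  shows "levi_civita i' j' k' l' m' = - levi_civita i j k l m"
proof -
  have bij: "bij (idx_map i' j' k' l' m') \<longleftrightarrow> bij (idx_map i j k l m)"
  proof
    have "idx_map i j k l m = idx_map i' j' k' l' m' \<circ> Transposition.transpose a b"
      unfolding assms(1) comp_assoc transpose_comp_involutory by simp
    then show "bij (idx_map i' j' k' l' m') \<Longrightarrow> bij (idx_map i j k l m)"
      using bij_comp[OF bij_transpose] by metis
    show "bij (idx_map i j k l m) \<Longrightarrow> bij (idx_map i' j' k' l' m')"
      unfolding assms(1) by (rule bij_comp[OF bij_transpose])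
  qed
  show ?thesis
  proof (cases "bij (idx_map i j k l m)")
    case True
    then have "permutation (idx_map i j k l m)"
      unfolding permutation by simp
    from sign_compose[OF this permutation_swap_id[of a b]]
    have "sign (idx_map i' j' k' l' m') = - sign (idx_map i j k l m)"
      unfolding assms(1) sign_swap_id using assms(2) by simp
    then show ?thesis using True bij by (simp add: levi_civita_idx_map)
  next
    case False
    then show ?thesis using bij by (simp add: levi_civita_idx_map)
  qed
qed

lemma levi_civita_swap:
  "levi_civita j i k l m = - levi_civita i j k l m"
  "levi_civita i k j l m = - levi_civita i j k l m"
  "levi_civita i j l k m = - levi_civita i j k l m"
  "levi_civita i j k m l = - levi_civita i j k l m"
  subgoal
    by (rule levi_civita_transpose[where a=1 and b=2])
      (simp_all add: fun_eq_iff forall_5 idx_map_def Transposition.transpose_def)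
  subgoal
    by (rule levi_civita_transpose[where a=2 and b=3])
      (simp_all add: fun_eq_iff forall_5 idx_map_def Transposition.transpose_def)
  subgoal
    by (rule levi_civita_transpose[where a=3 and b=4])
      (simp_all add: fun_eq_iff forall_5 idx_map_def Transposition.transpose_def)
  subgoal
    by (rule levi_civita_transpose[where a=4 and b=5])
      (simp_all add: fun_eq_iff forall_5 idx_map_def Transposition.transpose_def)
  done

text \<open>Swapping two equal neighbours shows that the symbol equals its own negative. Equal
  indices farther apart are first moved together.\<close>

lemma levi_civita_repeated:
  "levi_civita i i k l m = 0" "levi_civita i j j l m = 0" "levi_civita i j k k m = 0"
  "levi_civita i j k l l = 0" "levi_civita i j i l m = 0" "levi_civita i j k j m = 0"
  "levi_civita i j k l k = 0" "levi_civita i j k i m = 0" "levi_civita i j k l j = 0"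
  "levi_civita i j k l i = 0"
proof -
  show r1: "levi_civita i i k l m = 0" for i k l m
    using levi_civita_swap(1)[of i i k l m] by linarith
  show r2: "levi_civita i j j l m = 0" for i j l m
    using levi_civita_swap(2)[of i j j l m] by linarith
  show r3: "levi_civita i j k k m = 0" for i j k m
    using levi_civita_swap(3)[of i j k k m] by linarith
  show r4: "levi_civita i j k l l = 0" for i j k l
    using levi_civita_swap(4)[of i j k l l] by linarith
  show r5: "levi_civita i j i l m = 0" for i j l m
    using levi_civita_swap(1)[of j i i l m] r2[of j i l m] by linarith
  show r6: "levi_civita i j k j m = 0" for i j k m
    using levi_civita_swap(2)[of i k j j m] r3[of i k j m] by linarith
  show r7: "levi_civita i j k l k = 0" for i j k l
    using levi_civita_swap(3)[of i j l k k] r4[of i j l k] by linarith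
  show r8: "levi_civita i j k i m = 0" for i j k m
    using levi_civita_swap(1)[of j i k i m] r6[of j i k m] by linarith
  show r9: "levi_civita i j k l j = 0" for i j k l
    using levi_civita_swap(2)[of i k j l j] r7[of i k j l] by linarith
  show "levi_civita i j k l i = 0"
    using levi_civita_swap(1)[of j i k l i] r9[of j i k l] by linarith
qed

text \<open>In this type 5 equals 0; the rank places it last, so that the sorted tuple is the one on
  which the symbol is normalised.\<close>

definition rank_5 :: "5 \<Rightarrow> nat" where
  "rank_5 x = (if x = 1 then 1 else if x = 2 then 2 else if x = 3 then 3 else if x = 4 then 4 else 5)"

lemma rank_5_simps: "rank_5 1 = 1" "rank_5 2 = 2" "rank_5 3 = 3" "rank_5 4 = 4" "rank_5 5 = 5"
  by (simp_all add: rank_5_def)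

text \<open>Guarding the transpositions by the order of the indices turns them into a terminating
  sorting procedure for the simplifier.\<close>

lemma levi_civita_sort:
  "rank_5 i < rank_5 j \<Longrightarrow> levi_civita j i k l m = - levi_civita i j k l m"
  "rank_5 j < rank_5 k \<Longrightarrow> levi_civita i k j l m = - levi_civita i j k l m"
  "rank_5 k < rank_5 l \<Longrightarrow> levi_civita i j l k m = - levi_civita i j k l m"
  "rank_5 l < rank_5 m \<Longrightarrow> levi_civita i j k m l = - levi_civita i j k l m"
  by (rule levi_civita_swap)+

lemma levi_civita_12345: "levi_civita 1 2 3 4 5 = 1"
proof -
  have "idx_map 1 2 3 4 5 = id" by (simp add: fun_eq_iff forall_5 idx_map_def)
  then show ?thesis by (simp add: levi_civita_idx_map sign_id)
qed

text \<open>Moving one pair past the other takes four adjacent transpositions, an even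
  number.\<close>

lemma levi_civita_pair_swap: "levi_civita i l m j k = levi_civita i j k l m"
  using levi_civita_swap(3)[of i l m j k] levi_civita_swap(2)[of i l j m k]
    levi_civita_swap(4)[of i j l m k] levi_civita_swap(3)[of i j l k m] by linarith

section \<open>Polynomial identities for antisymmetric matrices\<close>

lemma antisym_matsD: "B \<in> antisym_mats \<Longrightarrow> B $ i $ j = - B $ j $ i"
  unfolding antisym_mats_def by blast

lemma antisym_mats_diagonal: "B \<in> antisym_mats \<Longrightarrow> B $ i $ i = 0"
  using antisym_matsD[of B i i] by linarith

lemma antisym_mats_entries:
  assumes "B \<in> antisym_mats"
  shows "B $ 2 $ 1 = - B $ 1 $ 2" "B $ 3 $ 1 = - B $ 1 $ 3" "B $ 4 $ 1 = - B $ 1 $ 4"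
    "B $ 5 $ 1 = - B $ 1 $ 5" "B $ 3 $ 2 = - B $ 2 $ 3" "B $ 4 $ 2 = - B $ 2 $ 4"
    "B $ 5 $ 2 = - B $ 2 $ 5" "B $ 4 $ 3 = - B $ 3 $ 4" "B $ 5 $ 3 = - B $ 3 $ 5"
    "B $ 5 $ 4 = - B $ 4 $ 5"
  by (rule antisym_matsD[OF assms])+

text \<open>Component i is, up to the sign (-1)^(i+1), the Pfaffian of \<open>B\<close> with row and
  column i deleted: each of its three pairings occurs 8 times, which cancels the factor 1/8.\<close>

lemma p_vec_explicit:
  assumes "B \<in> antisym_mats"
  shows "p_vec B $ 1 = B$2$3 * B$4$5 - B$2$4 * B$3$5 + B$2$5 * B$3$4"
    "p_vec B $ 2 = - (B$1$3 * B$4$5 - B$1$4 * B$3$5 + B$1$5 * B$3$4)"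
    "p_vec B $ 3 = B$1$2 * B$4$5 - B$1$4 * B$2$5 + B$1$5 * B$2$4"
    "p_vec B $ 4 = - (B$1$2 * B$3$5 - B$1$3 * B$2$5 + B$1$5 * B$2$3)"
    "p_vec B $ 5 = B$1$2 * B$3$4 - B$1$3 * B$2$4 + B$1$4 * B$2$3"
  by (simp_all add: p_vec_def sum_5 levi_civita_repeated levi_civita_sort rank_5_simps
      levi_civita_12345 antisym_mats_entries[OF assms] antisym_mats_diagonal[OF assms])
text \<open>The matrix G of the overview: the Hodge dual of p wedge B, and the conjugate field of
  p^2 / 2.\<close>

definition dual_field :: "mat5 \<Rightarrow> mat5" where
  "dual_field B = (\<chi> l m. 1/2 * (\<Sum>i\<in>UNIV. \<Sum>j\<in>UNIV. \<Sum>k\<in>UNIV.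
     levi_civita i j k l m * p_vec B $ i * B $ j $ k))"

lemma dual_field_antisym: "dual_field B \<in> antisym_mats"
proof -
  have swap: "(\<Sum>i\<in>UNIV. \<Sum>j\<in>UNIV. \<Sum>k\<in>UNIV. levi_civita i j k l m * p_vec B $ i * B $ j $ k) =
    (\<Sum>i\<in>UNIV. \<Sum>j\<in>UNIV. \<Sum>k\<in>UNIV. - (levi_civita i j k m l * p_vec B $ i * B $ j $ k))" for l m
    by (intro sum.cong refl) (subst levi_civita_swap(4), simp)
  have "dual_field B $ l $ m = - dual_field B $ m $ l" for l m
    unfolding dual_field_def vec_lambda_beta swap[of l m] sum_negf by simp
  then show ?thesis
    unfolding antisym_mats_def by blast
qed

lemma dual_field_explicit:
  assumes "B \<in> antisym_mats"
  shows
    "dual_field B $ 1 $ 2 = p_vec B $ 3 * B$4$5 - p_vec B $ 4 * B$3$5 + p_vec B $ 5 * B$3$4"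
    "dual_field B $ 1 $ 3 = - (p_vec B $ 2 * B$4$5 - p_vec B $ 4 * B$2$5 + p_vec B $ 5 * B$2$4)"
    "dual_field B $ 1 $ 4 = p_vec B $ 2 * B$3$5 - p_vec B $ 3 * B$2$5 + p_vec B $ 5 * B$2$3"
    "dual_field B $ 1 $ 5 = - (p_vec B $ 2 * B$3$4 - p_vec B $ 3 * B$2$4 + p_vec B $ 4 * B$2$3)"
    "dual_field B $ 2 $ 3 = p_vec B $ 1 * B$4$5 - p_vec B $ 4 * B$1$5 + p_vec B $ 5 * B$1$4"
    "dual_field B $ 2 $ 4 = - (p_vec B $ 1 * B$3$5 - p_vec B $ 3 * B$1$5 + p_vec B $ 5 * B$1$3)"
    "dual_field B $ 2 $ 5 = p_vec B $ 1 * B$3$4 - p_vec B $ 3 * B$1$4 + p_vec B $ 4 * B$1$3"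
    "dual_field B $ 3 $ 4 = p_vec B $ 1 * B$2$5 - p_vec B $ 2 * B$1$5 + p_vec B $ 5 * B$1$2"
    "dual_field B $ 3 $ 5 = - (p_vec B $ 1 * B$2$4 - p_vec B $ 2 * B$1$4 + p_vec B $ 4 * B$1$2)"
    "dual_field B $ 4 $ 5 = p_vec B $ 1 * B$2$3 - p_vec B $ 2 * B$1$3 + p_vec B $ 3 * B$1$2"
  by (simp_all add: dual_field_def sum_5 levi_civita_repeated levi_civita_sort rank_5_simps
      levi_civita_12345 antisym_mats_entries[OF assms] antisym_mats_diagonal[OF assms])

text \<open>The sum is, up to sign, the expansion along the last row of the Pfaffian of the 6 x 6
  matrix obtained by duplicating row and column i of \<open>B\<close>, hence zero. The proof checks
  the polynomials entry by entry.\<close>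

lemma antisym_mat_p_vec:
  assumes "B \<in> antisym_mats"
  shows "(\<Sum>j\<in>UNIV. B $ i $ j * p_vec B $ j) = 0"
proof -
  have "\<forall>i. (\<Sum>j\<in>UNIV. B $ i $ j * p_vec B $ j) = 0"
    unfolding forall_5
    by (simp add: sum_5 p_vec_explicit[OF assms] antisym_mats_entries[OF assms]
        antisym_mats_diagonal[OF assms]) (simp add: algebra_simps)
  then show ?thesis ..
qed

text \<open>On the hyperplane orthogonal to a nonzero p this is the four-dimensional identity that
  the dual of a 2-form times the transposed form is the Pfaffian times the identity. The proof
  compares polynomials, so no adapted basis is chosen.\<close>

lemma dual_field_mult_transpose:
  assumes "B \<in> antisym_mats"
  shows "(\<Sum>k\<in>UNIV. dual_field B $ i $ k * B $ j $ k) =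
    (if i = j then (\<Sum>k\<in>UNIV. p_vec B $ k * p_vec B $ k) else 0) - p_vec B $ i * p_vec B $ j"
proof -
  note entries = antisym_mats_entries[OF assms] antisym_mats_diagonal[OF assms]
    antisym_mats_entries[OF dual_field_antisym] antisym_mats_diagonal[OF dual_field_antisym]
  have "\<forall>i j. (\<Sum>k\<in>UNIV. dual_field B $ i $ k * B $ j $ k) =
    (if i = j then (\<Sum>k\<in>UNIV. p_vec B $ k * p_vec B $ k) else 0) - p_vec B $ i * p_vec B $ j"
    unfolding forall_5
    by (simp add: sum_5 entries dual_field_explicit[OF assms] p_vec_explicit[OF assms])
      (simp add: algebra_simps)
  then show ?thesis by blast
qed

lemma p_inv_square: "(p_inv B)\<^sup>2 = (\<Sum>i\<in>UNIV. p_vec B $ i * p_vec B $ i)"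
  unfolding p_inv_def by (intro real_sqrt_pow2 sum_nonneg) simp

text \<open>In block form with skew eigenvalues b1 and b2, the Gram matrix has b1^2 and b2^2 as
  double eigenvalues besides 0, while s = (b1^2 + b2^2) / 2 and p = |b1 b2|.\<close>

lemma sum_gram_square:
  assumes "B \<in> antisym_mats"
  shows "(\<Sum>i\<in>UNIV. \<Sum>j\<in>UNIV. (\<Sum>k\<in>UNIV. B $ i $ k * B $ j $ k)\<^sup>2) =
    8 * (s_inv B)\<^sup>2 - 4 * (p_inv B)\<^sup>2"
  unfolding p_inv_square s_inv_def
  by (simp add: sum_5 p_vec_explicit[OF assms] antisym_mats_entries[OF assms]
      antisym_mats_diagonal[OF assms]) (simp add: algebra_simps power2_eq_square)

text \<open>The spatial stress block has this shape with \<open>A = gram B\<close> and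
  \<open>v = p_vec B\<close>; the last cross term then vanishes by
  \<open>gram_p_vec\<close>.\<close>

lemma sum_square_perturbed_scalar_matrix:
  fixes A :: mat5 and v :: "real ^ 5" and c a b :: real
  shows "(\<Sum>i\<in>UNIV. \<Sum>j\<in>UNIV. ((if i = j then c else 0) + a * A $ i $ j + b * (v $ i * v $ j))\<^sup>2) =
    5 * c\<^sup>2 + a\<^sup>2 * (\<Sum>i\<in>UNIV. \<Sum>j\<in>UNIV. (A $ i $ j)\<^sup>2) + b\<^sup>2 * (\<Sum>i\<in>UNIV. v $ i * v $ i)\<^sup>2
    + 2 * c * a * (\<Sum>i\<in>UNIV. A $ i $ i) + 2 * c * b * (\<Sum>i\<in>UNIV. v $ i * v $ i)
    + 2 * a * b * (\<Sum>i\<in>UNIV. \<Sum>j\<in>UNIV. A $ i $ j * (v $ i * v $ j))"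
  by (simp add: sum_5) (simp add: algebra_simps power2_eq_square)

section \<open>Gradients of the invariants\<close>

lemma has_derivative_entry:
  "((\<lambda>X :: mat5. X $ i $ j) has_derivative (\<lambda>D. D $ i $ j)) F"
  by (intro bounded_linear_imp_has_derivative
      bounded_linear_compose[OF bounded_linear_vec_nth bounded_linear_vec_nth])

lemma s_inv_has_derivative:
  "(s_inv has_derivative (\<lambda>D. 1/2 * (\<Sum>i\<in>UNIV. \<Sum>j\<in>UNIV. B $ i $ j * D $ i $ j))) (at B)"
proof -
  have "((\<lambda>X. 1/4 * (\<Sum>i\<in>UNIV. \<Sum>j\<in>UNIV. X $ i $ j * X $ i $ j)) has_derivative
    (\<lambda>D. 1/4 * (\<Sum>i\<in>UNIV. \<Sum>j\<in>UNIV. B $ i $ j * D $ i $ j + D $ i $ j * B $ i $ j))) (at B)"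
    by (intro has_derivative_mult_right has_derivative_sum has_derivative_mult has_derivative_entry)
  moreover have "1/4 * (\<Sum>i\<in>UNIV. \<Sum>j\<in>UNIV. B $ i $ j * D $ i $ j + D $ i $ j * B $ i $ j) =
      1/2 * (\<Sum>i\<in>UNIV. \<Sum>j\<in>UNIV. B $ i $ j * D $ i $ j)" for D :: mat5
    by (simp add: sum_distrib_left mult.commute)
  ultimately show ?thesis
    unfolding s_inv_def[abs_def] by simp
qed

lemma sum_swap_pairs:
  "(\<Sum>j\<in>A. \<Sum>k\<in>B. \<Sum>l\<in>C. \<Sum>m\<in>D. f j k l m) =
   (\<Sum>l\<in>C. \<Sum>m\<in>D. \<Sum>j\<in>A. \<Sum>k\<in>B. f j k l m)"
proof -
  have "(\<Sum>j\<in>A. \<Sum>k\<in>B. \<Sum>l\<in>C. \<Sum>m\<in>D. f j k l m) =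
      (\<Sum>j\<in>A. \<Sum>l\<in>C. \<Sum>k\<in>B. \<Sum>m\<in>D. f j k l m)"
    by (intro sum.cong refl sum.swap)
  also have "\<dots> = (\<Sum>l\<in>C. \<Sum>j\<in>A. \<Sum>m\<in>D. \<Sum>k\<in>B. f j k l m)"
    by (subst sum.swap) (intro sum.cong refl sum.swap)
  also have "\<dots> = (\<Sum>l\<in>C. \<Sum>m\<in>D. \<Sum>j\<in>A. \<Sum>k\<in>B. f j k l m)"
    by (intro sum.cong refl sum.swap)
  finally show ?thesis .
qed

lemma p_vec_has_derivative:
  "((\<lambda>X. p_vec X $ i) has_derivative (\<lambda>D. 1/4 * (\<Sum>l\<in>UNIV. \<Sum>m\<in>UNIV. \<Sum>j\<in>UNIV. \<Sum>k\<in>UNIV.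
      levi_civita i j k l m * B $ j $ k * D $ l $ m))) (at B)"
proof -
  have "((\<lambda>X. 1/8 * (\<Sum>j\<in>UNIV. \<Sum>k\<in>UNIV. \<Sum>l\<in>UNIV. \<Sum>m\<in>UNIV.
      levi_civita i j k l m * X $ j $ k * X $ l $ m)) has_derivative
    (\<lambda>D. 1/8 * (\<Sum>j\<in>UNIV. \<Sum>k\<in>UNIV. \<Sum>l\<in>UNIV. \<Sum>m\<in>UNIV.
      levi_civita i j k l m * B $ j $ k * D $ l $ m + levi_civita i j k l m * D $ j $ k * B $ l $ m))) (at B)"
    by (intro has_derivative_mult_right has_derivative_sum has_derivative_mult has_derivative_entry)
  moreover have "1/8 * (\<Sum>j\<in>UNIV. \<Sum>k\<in>UNIV. \<Sum>l\<in>UNIV. \<Sum>m\<in>UNIV.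
      levi_civita i j k l m * B $ j $ k * D $ l $ m + levi_civita i j k l m * D $ j $ k * B $ l $ m)
    = 1/4 * (\<Sum>l\<in>UNIV. \<Sum>m\<in>UNIV. \<Sum>j\<in>UNIV. \<Sum>k\<in>UNIV. levi_civita i j k l m * B $ j $ k * D $ l $ m)"
    (is "_ = 1/4 * ?S")
    for D :: mat5
  proof -
    \<comment> \<open>The two product-rule terms agree after exchanging the index pairs, which
      doubles 1/8 to 1/4.\<close>
    have "(\<Sum>j\<in>UNIV. \<Sum>k\<in>UNIV. \<Sum>l\<in>UNIV. \<Sum>m\<in>UNIV. levi_civita i j k l m * D $ j $ k * B $ l $ m) = ?S"
      by (intro sum.cong refl) (subst levi_civita_pair_swap, simp add: mult_ac)
    moreover have "(\<Sum>j\<in>UNIV. \<Sum>k\<in>UNIV. \<Sum>l\<in>UNIV. \<Sum>m\<in>UNIV. levi_civita i j k l m * B $ j $ k * D $ l $ m) = ?S"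
      by (rule sum_swap_pairs)
    ultimately show ?thesis
      by (simp only: sum.distrib) simp
  qed
  ultimately show ?thesis
    unfolding p_vec_def by simp
qed

text \<open>Chain rule for the square root of p^2; positivity keeps the argument away from 0, where
  the root is not differentiable.\<close>

lemma p_inv_has_derivative:
  assumes "p_inv B > 0"
  shows "(p_inv has_derivative
    (\<lambda>D. 1/2 * (\<Sum>l\<in>UNIV. \<Sum>m\<in>UNIV. dual_field B $ l $ m / p_inv B * D $ l $ m))) (at B)"
proof -
  define dp where "dp i D = 1/4 * (\<Sum>l\<in>UNIV. \<Sum>m\<in>UNIV. \<Sum>j\<in>UNIV. \<Sum>k\<in>UNIV.
      levi_civita i j k l m * B $ j $ k * D $ l $ m)" for i and D :: mat5
  define q where "q X = (\<Sum>i\<in>UNIV. p_vec X $ i * p_vec X $ i)" for X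
  have q: "q B > 0"
    using assms by (simp add: p_inv_def q_def)
  have "(q has_derivative (\<lambda>D. \<Sum>i\<in>UNIV. p_vec B $ i * dp i D + dp i D * p_vec B $ i)) (at B)"
    unfolding q_def dp_def by (intro has_derivative_sum has_derivative_mult p_vec_has_derivative)
  from has_derivative_real_sqrt[OF q this]
  have deriv: "(p_inv has_derivative (\<lambda>D. (\<Sum>i\<in>UNIV. p_vec B $ i * dp i D + dp i D * p_vec B $ i)
      * inverse (sqrt (q B)) / 2)) (at B)"
    unfolding p_inv_def[abs_def] q_def[abs_def] by (simp add: field_simps)
  \<comment> \<open>Two equal terms with coefficient 1/4 produce the 1/2 in
    \<open>dual_field\<close>.\<close>
  have contract: "(\<Sum>i\<in>UNIV. p_vec B $ i * dp i D + dp i D * p_vec B $ i) =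
      (\<Sum>l\<in>UNIV. \<Sum>m\<in>UNIV. dual_field B $ l $ m * D $ l $ m)" for D
  proof -
    have "(\<Sum>i\<in>UNIV. p_vec B $ i * dp i D + dp i D * p_vec B $ i) =
      (\<Sum>i\<in>UNIV. \<Sum>l\<in>UNIV. \<Sum>m\<in>UNIV.
        1/2 * (\<Sum>j\<in>UNIV. \<Sum>k\<in>UNIV. levi_civita i j k l m * p_vec B $ i * B $ j $ k) * D $ l $ m)"
      unfolding dp_def by (simp add: sum_distrib_left sum_distrib_right mult_ac)
    also have "\<dots> = (\<Sum>l\<in>UNIV. \<Sum>m\<in>UNIV. \<Sum>i\<in>UNIV.
        1/2 * (\<Sum>j\<in>UNIV. \<Sum>k\<in>UNIV. levi_civita i j k l m * p_vec B $ i * B $ j $ k) * D $ l $ m)"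
      by (subst sum.swap) (intro sum.cong refl sum.swap)
    also have "\<dots> = (\<Sum>l\<in>UNIV. \<Sum>m\<in>UNIV. dual_field B $ l $ m * D $ l $ m)"
      unfolding dual_field_def by (simp add: sum_distrib_left sum_distrib_right)
    finally show ?thesis .
  qed
  have scale: "S * inverse (sqrt (q B)) / 2 = 1/2 * (S / p_inv B)" for S
    by (simp add: p_inv_def q_def inverse_eq_divide)
  show ?thesis
    using deriv unfolding contract scale by (simp add: sum_divide_distrib)
qed

section \<open>Uniqueness and evaluation of the conjugate field\<close>

lemma antisym_mats_linear_combination:
  assumes "A \<in> antisym_mats" "B \<in> antisym_mats"
  shows "a *\<^sub>R A + b *\<^sub>R B \<in> antisym_mats"
proof -
  have "(a *\<^sub>R A + b *\<^sub>R B) $ i $ j = - (a *\<^sub>R A + b *\<^sub>R B) $ j $ i" for i j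
    using antisym_matsD[OF assms(1), of i j] antisym_matsD[OF assms(2), of i j]
    by (simp only: vector_add_component vector_scaleR_component real_scaleR_def)
  then show ?thesis
    unfolding antisym_mats_def by blast
qed

text \<open>A derivative within a proper subspace is determined only along that subspace.
  Restricting to the line through \<open>B\<close> in the admissible direction
  \<open>D = H - H'\<close> gives equal ordinary derivatives, hence
  \<open>D \<bullet> D = 0\<close>.\<close>

lemma antisym_gradient_unique:
  assumes "H \<in> antisym_mats" "H' \<in> antisym_mats"
    and "(f has_derivative (\<lambda>D. 1/2 * (\<Sum>i\<in>UNIV. \<Sum>j\<in>UNIV. H $ i $ j * D $ i $ j)))
           (at B within antisym_mats)"
    and "(f has_derivative (\<lambda>D. 1/2 * (\<Sum>i\<in>UNIV. \<Sum>j\<in>UNIV. H' $ i $ j * D $ i $ j)))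
           (at B within antisym_mats)"
    and "B \<in> antisym_mats"
  shows "H = H'"
proof -
  define D where "D = H - H'"
  have "D \<in> antisym_mats"
    using antisym_mats_linear_combination[OF assms(1,2), of 1 "-1"] by (simp add: D_def)
  from antisym_mats_linear_combination[OF assms(5) this, of 1]
  have line: "B + t *\<^sub>R D \<in> antisym_mats" for t by simp
  have "((\<lambda>t. f (B + t *\<^sub>R D)) has_real_derivative
      1/2 * (\<Sum>i\<in>UNIV. \<Sum>j\<in>UNIV. K $ i $ j * D $ i $ j)) (at 0)"
    if "(f has_derivative (\<lambda>D. 1/2 * (\<Sum>i\<in>UNIV. \<Sum>j\<in>UNIV. K $ i $ j * D $ i $ j)))
           (at B within antisym_mats)" for K :: mat5
  proof -
    have "((\<lambda>t. B + t *\<^sub>R D) has_derivative (\<lambda>t. t *\<^sub>R D)) (at (0::real))"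
      by (auto intro!: derivative_eq_intros)
    moreover have "(f has_derivative (\<lambda>D. 1/2 * (\<Sum>i\<in>UNIV. \<Sum>j\<in>UNIV. K $ i $ j * D $ i $ j)))
           (at (B + 0 *\<^sub>R D) within range (\<lambda>t. B + t *\<^sub>R D))"
      using line has_derivative_subset[OF that, of "range (\<lambda>t. B + t *\<^sub>R D)"]
      by (simp add: image_subset_iff)
    ultimately have "((\<lambda>t. f (B + t *\<^sub>R D)) has_derivative
        (\<lambda>t. 1/2 * (\<Sum>i\<in>UNIV. \<Sum>j\<in>UNIV. K $ i $ j * (t *\<^sub>R D) $ i $ j))) (at 0)"
      by (rule has_derivative_in_compose)
    moreover have "1/2 * (\<Sum>i\<in>UNIV. \<Sum>j\<in>UNIV. K $ i $ j * (t *\<^sub>R D) $ i $ j) =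
        1/2 * (\<Sum>i\<in>UNIV. \<Sum>j\<in>UNIV. K $ i $ j * D $ i $ j) * t" for t
      by (simp add: sum_distrib_left sum_distrib_right mult_ac)
    ultimately show ?thesis
      unfolding has_field_derivative_def by (simp only:)
  qed
  from DERIV_unique[OF this[OF assms(3)] this[OF assms(4)]]
  have "(\<Sum>i\<in>UNIV. \<Sum>j\<in>UNIV. H $ i $ j * D $ i $ j) - (\<Sum>i\<in>UNIV. \<Sum>j\<in>UNIV. H' $ i $ j * D $ i $ j) = 0"
    by simp
  then have "(\<Sum>i\<in>UNIV. \<Sum>j\<in>UNIV. D $ i $ j * D $ i $ j) = 0"
    by (simp add: D_def left_diff_distrib sum_subtractf)
  then have "D \<bullet> D = 0"
    by (simp add: inner_vec_def)
  then show ?thesis by (simp add: D_def)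
qed

text \<open>The chain rule supplies a witness for the definite description, and
  \<open>antisym_gradient_unique\<close> excludes any other.\<close>

lemma conj_field_eq:
  assumes "B \<in> antisym_mats" and "p_inv B > 0"
    and "((\<lambda>(s, p). h s p) has_derivative (\<lambda>(s, p). hs * s + hp * p)) (at (s_inv B, p_inv B))"
  shows "conj_field h B = hs *\<^sub>R B + (hp / p_inv B) *\<^sub>R dual_field B" (is "_ = ?H")
proof -
  have "?H \<in> antisym_mats"
    by (intro antisym_mats_linear_combination assms(1) dual_field_antisym)
  moreover have "((\<lambda>X. h (s_inv X) (p_inv X)) has_derivative
      (\<lambda>D. 1/2 * (\<Sum>i\<in>UNIV. \<Sum>j\<in>UNIV. ?H $ i $ j * D $ i $ j))) (at B within antisym_mats)"
  proof -
    have "((\<lambda>X. (s_inv X, p_inv X)) has_derivative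
      (\<lambda>D. (1/2 * (\<Sum>i\<in>UNIV. \<Sum>j\<in>UNIV. B $ i $ j * D $ i $ j),
        1/2 * (\<Sum>i\<in>UNIV. \<Sum>j\<in>UNIV. dual_field B $ i $ j / p_inv B * D $ i $ j)))) (at B)"
      by (intro has_derivative_Pair s_inv_has_derivative p_inv_has_derivative assms)
    from has_derivative_compose[OF this assms(3)]
    have "((\<lambda>X. h (s_inv X) (p_inv X)) has_derivative
      (\<lambda>D. hs * (1/2 * (\<Sum>i\<in>UNIV. \<Sum>j\<in>UNIV. B $ i $ j * D $ i $ j)) +
        hp * (1/2 * (\<Sum>i\<in>UNIV. \<Sum>j\<in>UNIV. dual_field B $ i $ j / p_inv B * D $ i $ j)))) (at B)"
      by simp
    moreover have "hs * (1/2 * (\<Sum>i\<in>UNIV. \<Sum>j\<in>UNIV. B $ i $ j * D $ i $ j)) +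
        hp * (1/2 * (\<Sum>i\<in>UNIV. \<Sum>j\<in>UNIV. dual_field B $ i $ j / p_inv B * D $ i $ j)) =
        1/2 * (\<Sum>i\<in>UNIV. \<Sum>j\<in>UNIV. ?H $ i $ j * D $ i $ j)" for D :: mat5
      by (simp add: sum_distrib_left sum.distrib ring_distribs mult_ac)
    ultimately have "((\<lambda>X. h (s_inv X) (p_inv X)) has_derivative
        (\<lambda>D. 1/2 * (\<Sum>i\<in>UNIV. \<Sum>j\<in>UNIV. ?H $ i $ j * D $ i $ j))) (at B)"
      by (simp only:)
    then show ?thesis
      by (rule has_derivative_at_withinI)
  qed
  ultimately show ?thesis
    unfolding conj_field_def
    by (intro the_equality) (use antisym_gradient_unique assms(1) in blast)+
qed

section \<open>The energy-momentum tensor\<close>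

lemma sum_option_UNIV:
  fixes f :: "'a :: finite option \<Rightarrow> 'b :: comm_monoid_add"
  shows "sum f UNIV = f None + (\<Sum>i\<in>UNIV. f (Some i))"
  by (simp add: UNIV_option_conv sum.reindex)

lemma tensor_square_components:
  "tensor_square T = (T None None)\<^sup>2 - (\<Sum>i\<in>UNIV. (T None (Some i))\<^sup>2)
     - (\<Sum>i\<in>UNIV. (T (Some i) None)\<^sup>2) + (\<Sum>i\<in>UNIV. \<Sum>j\<in>UNIV. (T (Some i) (Some j))\<^sup>2)"
proof -
  have "raise2 T \<mu> \<nu> = minkowski \<mu> \<mu> * minkowski \<nu> \<nu> * T \<mu> \<nu>" for \<mu> \<nu>
  proof -
    \<comment> \<open>Since the metric is diagonal, only one term of the double sum survives; nested
      conditionals let the simplifier collapse it.\<close>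
    have "raise2 T \<mu> \<nu> = (\<Sum>\<alpha>\<in>UNIV. \<Sum>\<beta>\<in>UNIV. if \<beta> = \<nu> then
        if \<alpha> = \<mu> then minkowski \<mu> \<mu> * minkowski \<nu> \<nu> * T \<mu> \<nu> else 0 else 0)"
      unfolding raise2_def by (intro sum.cong refl) (simp add: minkowski_def)
    then show ?thesis by simp
  qed
  then show ?thesis
    by (simp add: tensor_square_def sum_option_UNIV minkowski_def sum.distrib sum_negf sum_subtractf power2_eq_square)
qed

lemma tensor_trace_components:
  "tensor_trace T = - T None None + (\<Sum>i\<in>UNIV. T (Some i) (Some i))"
  by (simp add: tensor_trace_def sum_option_UNIV minkowski_def mult_delta_left)

definition gram :: "mat5 \<Rightarrow> mat5" where
  "gram B = (\<chi> i j. \<Sum>k\<in>UNIV. B $ i $ k * B $ j $ k)"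

text \<open>The quadratic form is the squared norm of the transpose of \<open>B\<close> applied to
  p, and p lies in its kernel.\<close>

lemma gram_p_vec:
  assumes "B \<in> antisym_mats"
  shows "(\<Sum>i\<in>UNIV. \<Sum>j\<in>UNIV. gram B $ i $ j * (p_vec B $ i * p_vec B $ j)) = 0"
proof -
  have column: "(\<Sum>j\<in>UNIV. B $ j $ k * p_vec B $ j) = 0" for k
  proof -
    have "(\<Sum>j\<in>UNIV. B $ j $ k * p_vec B $ j) = (\<Sum>j\<in>UNIV. - (B $ k $ j * p_vec B $ j))"
      by (intro sum.cong refl) (subst antisym_matsD[OF assms], simp)
    then show ?thesis
      using antisym_mat_p_vec[OF assms, of k] by (simp add: sum_negf)
  qed
  have "(\<Sum>j\<in>UNIV. gram B $ i $ j * (p_vec B $ i * p_vec B $ j)) = 0" for i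
  proof -
    have "(\<Sum>j\<in>UNIV. gram B $ i $ j * (p_vec B $ i * p_vec B $ j)) =
      (\<Sum>j\<in>UNIV. \<Sum>k\<in>UNIV. p_vec B $ i * B $ i $ k * (B $ j $ k * p_vec B $ j))"
      by (simp add: gram_def sum_distrib_left sum_distrib_right mult_ac)
    also have "\<dots> = (\<Sum>k\<in>UNIV. p_vec B $ i * B $ i $ k * (\<Sum>j\<in>UNIV. B $ j $ k * p_vec B $ j))"
      by (subst sum.swap) (simp add: sum_distrib_left)
    finally show ?thesis by (simp add: column)
  qed
  then show ?thesis by simp
qed

lemma gram_trace: "(\<Sum>i\<in>UNIV. gram B $ i $ i) = 4 * s_inv B"
  by (simp add: gram_def s_inv_def)

lemma em_tensor_invariants:
  fixes h :: "real \<Rightarrow> real \<Rightarrow> real"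
  assumes B: "B \<in> antisym_mats" and p: "p_inv B > 0"
    and deriv: "((\<lambda>(s, p). h s p) has_derivative (\<lambda>(s, p). hs * s + hp * p)) (at (s_inv B, p_inv B))"
  defines "h0 \<equiv> h (s_inv B) (p_inv B)" and "x \<equiv> s_inv B * hs + p_inv B * hp"
  shows "tensor_trace (em_tensor h B) = 6 * (x - h0)"
    and "tensor_square (em_tensor h B) = 6 * h0\<^sup>2 - 12 * h0 * x + 8 * x\<^sup>2 - 2 * (p_inv B)\<^sup>2
      + 4 * hs\<^sup>2 * ((s_inv B)\<^sup>2 - (p_inv B)\<^sup>2)"
proof -
  define a where "a = hp / p_inv B"
  \<comment> \<open>The scalar part of the stress: \<open>2 * x - h0\<close> comes from the pressure
    term, since the full contraction of H with B is \<open>4 * x\<close>, and the rest from the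
    identity part of G times B transposed.\<close>
  define c where "c = 2 * x - h0 - a * (p_inv B)\<^sup>2"
  have ap: "a * (p_inv B)\<^sup>2 = hp * p_inv B"
    using p by (simp add: a_def power2_eq_square)
  note conj = conj_field_eq[OF B p deriv, folded a_def]
  have HB: "(\<Sum>k\<in>UNIV. conj_field h B $ i $ k * B $ j $ k) =
      hs * gram B $ i $ j + a * ((if i = j then (p_inv B)\<^sup>2 else 0) - p_vec B $ i * p_vec B $ j)" for i j
  proof -
    have "(\<Sum>k\<in>UNIV. conj_field h B $ i $ k * B $ j $ k) =
      hs * gram B $ i $ j + a * (\<Sum>k\<in>UNIV. dual_field B $ i $ k * B $ j $ k)"
      by (simp add: conj gram_def sum_distrib_left sum.distrib ring_distribs mult_ac)
    then show ?thesis
      by (simp only: dual_field_mult_transpose[OF B] p_inv_square)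
  qed
  \<comment> \<open>This is Euler's relation: s and p are homogeneous of degree two in B.\<close>
  have tr: "(\<Sum>i\<in>UNIV. \<Sum>k\<in>UNIV. conj_field h B $ i $ k * B $ i $ k) = 4 * x"
  proof -
    have "(\<Sum>i\<in>UNIV. \<Sum>k\<in>UNIV. conj_field h B $ i $ k * B $ i $ k) =
      hs * (\<Sum>i\<in>UNIV. gram B $ i $ i) + a * (5 * (p_inv B)\<^sup>2 - (\<Sum>i\<in>UNIV. p_vec B $ i * p_vec B $ i))"
      unfolding HB by (simp add: sum.distrib sum_subtractf flip: sum_distrib_left)
    also have "\<dots> = 4 * x"
      unfolding p_inv_square[symmetric] gram_trace x_def using ap by (simp add: algebra_simps)
    finally show ?thesis .
  qed
  have T: "em_tensor h B (Some i) (Some j) =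
      (if i = j then c else 0) + (- hs) * gram B $ i $ j + a * (p_vec B $ i * p_vec B $ j)" for i j
    unfolding em_tensor_def Let_def option.case tr unfolding HB c_def h0_def by (simp add: algebra_simps)
  have T0: "em_tensor h B None None = h0" "em_tensor h B None (Some i) = - p_vec B $ i"
    "em_tensor h B (Some i) None = - p_vec B $ i" for i
    by (simp_all add: em_tensor_def h0_def Let_def)
  have "tensor_trace (em_tensor h B) = - h0 + (5 * c - hs * (4 * s_inv B) + a * (p_inv B)\<^sup>2)"
    unfolding tensor_trace_components T T0 gram_trace[symmetric] p_inv_square
    by (simp add: sum.distrib sum_subtractf flip: sum_distrib_left)
  then show "tensor_trace (em_tensor h B) = 6 * (x - h0)"
    unfolding c_def ap x_def by (simp add: algebra_simps)
  have "(\<Sum>i\<in>UNIV. \<Sum>j\<in>UNIV. (em_tensor h B (Some i) (Some j))\<^sup>2) =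
    5 * c\<^sup>2 + hs\<^sup>2 * (8 * (s_inv B)\<^sup>2 - 4 * (p_inv B)\<^sup>2) + a\<^sup>2 * ((p_inv B)\<^sup>2)\<^sup>2
    - 2 * c * hs * (4 * s_inv B) + 2 * c * a * (p_inv B)\<^sup>2"
    unfolding T sum_square_perturbed_scalar_matrix gram_p_vec[OF B] gram_trace p_inv_square[symmetric]
    using sum_gram_square[OF B] by (simp add: gram_def)
  then have "tensor_square (em_tensor h B) = h0\<^sup>2 - 2 * (p_inv B)\<^sup>2 +
    (5 * c\<^sup>2 + hs\<^sup>2 * (8 * (s_inv B)\<^sup>2 - 4 * (p_inv B)\<^sup>2) + (a * (p_inv B)\<^sup>2)\<^sup>2
    - 2 * c * hs * (4 * s_inv B) + 2 * c * (a * (p_inv B)\<^sup>2))"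
    unfolding tensor_square_components T0 p_inv_square
    by (simp add: power2_eq_square mult_ac)
  then show "tensor_square (em_tensor h B) = 6 * h0\<^sup>2 - 12 * h0 * x + 8 * x\<^sup>2 - 2 * (p_inv B)\<^sup>2
      + 4 * hs\<^sup>2 * ((s_inv B)\<^sup>2 - (p_inv B)\<^sup>2)"
    unfolding c_def ap x_def by (simp add: algebra_simps power2_eq_square)
qed

section \<open>The ModMax-Born-Infeld Hamiltonian\<close>

text \<open>The bracket is nonnegative because |sinh| is at most cosh and the inner root is at most
  s.\<close>

lemma mmbi_radicand_pos:
  fixes s p lam \<gamma> :: real
  assumes "lam > 0" "s > p" "p > 0"
  shows "1 + 2 * lam * (s * cosh \<gamma> - sinh \<gamma> * sqrt (s\<^sup>2 - p\<^sup>2)) + lam\<^sup>2 * p\<^sup>2 > 0"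
proof -
  have "sqrt (s\<^sup>2 - p\<^sup>2) \<le> sqrt (s\<^sup>2)"
    by (intro real_sqrt_le_mono) simp
  then have r: "sqrt (s\<^sup>2 - p\<^sup>2) \<le> s"
    using assms by simp
  have "sinh \<gamma> * sqrt (s\<^sup>2 - p\<^sup>2) \<le> \<bar>sinh \<gamma>\<bar> * s"
    using assms r by (intro mult_mono) (auto simp: power_mono)
  also have "\<dots> \<le> cosh \<gamma> * s"
    using assms by (intro mult_right_mono) (use sinh_le_cosh_real[of \<gamma>] sinh_le_cosh_real[of "-\<gamma>"] in auto)
  finally have "0 \<le> s * cosh \<gamma> - sinh \<gamma> * sqrt (s\<^sup>2 - p\<^sup>2)"
    by (simp add: mult.commute)
  then show ?thesis
    using assms by (intro add_pos_nonneg) (auto intro!: add_pos_nonneg)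
qed

text \<open>The joint derivative feeds \<open>conj_field_eq\<close>, the one in s interprets the
  sign hypothesis on \<open>deriv\<close>, and the last two are the left sides of the flows. Both
  \<open>r\<close> and \<open>E\<close> are positive here, so both roots are differentiable.\<close>

lemma mmbi_derivatives:
  fixes s p lam \<gamma> :: real
  assumes lam: "lam > 0" and "s > p" "p > 0"
  defines "r \<equiv> sqrt (s\<^sup>2 - p\<^sup>2)"
  defines "u \<equiv> s * cosh \<gamma> - sinh \<gamma> * r"
  defines "E \<equiv> sqrt (1 + 2 * lam * u + lam\<^sup>2 * p\<^sup>2)"
  shows "((\<lambda>(s, p). mmbi \<gamma> lam s p) has_derivative
      (\<lambda>(ds, dp). ((cosh \<gamma> - sinh \<gamma> * s / r) / E) * ds + ((sinh \<gamma> * p / r + lam * p) / E) * dp)) (at (s, p))"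
    and "((\<lambda>s. mmbi \<gamma> lam s p) has_real_derivative (cosh \<gamma> - sinh \<gamma> * s / r) / E) (at s)"
    and "((\<lambda>l. mmbi \<gamma> l s p) has_real_derivative (u + lam * p\<^sup>2) / (lam * E) - (E - 1) / lam\<^sup>2) (at lam)"
    and "((\<lambda>g. mmbi g lam s p) has_real_derivative (s * sinh \<gamma> - cosh \<gamma> * r) / E) (at \<gamma>)"
proof -
  have sp: "0 < s\<^sup>2 - p\<^sup>2"
    using assms(2,3) by (simp add: power_strict_mono)
  have E: "0 < 1 + 2 * lam * (s * cosh \<gamma> - sinh \<gamma> * sqrt (s\<^sup>2 - p\<^sup>2)) + lam\<^sup>2 * p\<^sup>2"
    using mmbi_radicand_pos[OF assms(1-3)] .
  show "((\<lambda>(s, p). mmbi \<gamma> lam s p) has_derivative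
      (\<lambda>(ds, dp). ((cosh \<gamma> - sinh \<gamma> * s / r) / E) * ds + ((sinh \<gamma> * p / r + lam * p) / E) * dp)) (at (s, p))"
    unfolding mmbi_def case_prod_beta r_def u_def E_def
    using sp E lam by (auto intro!: derivative_eq_intros simp: fun_eq_iff divide_simps)
     (simp add: algebra_simps power2_eq_square)
  show "((\<lambda>s. mmbi \<gamma> lam s p) has_real_derivative (cosh \<gamma> - sinh \<gamma> * s / r) / E) (at s)"
    unfolding mmbi_def r_def u_def E_def
    using sp E lam by (auto intro!: derivative_eq_intros simp: divide_simps)
  show "((\<lambda>l. mmbi \<gamma> l s p) has_real_derivative (u + lam * p\<^sup>2) / (lam * E) - (E - 1) / lam\<^sup>2) (at lam)"
    unfolding mmbi_def r_def u_def E_def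
    using sp E lam by (auto intro!: derivative_eq_intros simp: divide_simps)
     (simp add: algebra_simps power2_eq_square)
  show "((\<lambda>g. mmbi g lam s p) has_real_derivative (s * sinh \<gamma> - cosh \<gamma> * r) / E) (at \<gamma>)"
    unfolding mmbi_def r_def u_def E_def
    using sp E lam by (auto intro!: derivative_eq_intros simp: divide_simps)
qed

section \<open>The two flow equations\<close>

theorem mainTheorem1:
  fixes \<gamma> lam :: real and B :: mat5
  assumes "lam > 0" and "\<gamma> \<ge> 0"
    and "B \<in> antisym_mats"
    and "s_inv B > p_inv B" and "p_inv B > 0"
    and "deriv (\<lambda>s. mmbi \<gamma> lam s (p_inv B)) (s_inv B) \<ge> 0"
  shows "((\<lambda>l. mmbi \<gamma> l (s_inv B) (p_inv B)) has_real_derivative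
            - O_T2 (em_tensor (mmbi \<gamma> lam) B)) (at lam)
       \<and> ((\<lambda>g. mmbi g lam (s_inv B) (p_inv B)) has_real_derivative
            - R_op (em_tensor (mmbi \<gamma> lam) B)) (at \<gamma>)"
proof -
  define s p where "s = s_inv B" and "p = p_inv B"
  define r where "r = sqrt (s\<^sup>2 - p\<^sup>2)"
  define u where "u = s * cosh \<gamma> - sinh \<gamma> * r"
  define E where "E = sqrt (1 + 2 * lam * u + lam\<^sup>2 * p\<^sup>2)"
  define hs where "hs = (cosh \<gamma> - sinh \<gamma> * s / r) / E"
  define hp where "hp = (sinh \<gamma> * p / r + lam * p) / E"
  define h0 where "h0 = mmbi \<gamma> lam s p"
  define x where "x = s * hs + p * hp"
  define y where "y = r * hs"
  note sp = assms(4,5)[folded s_def p_def]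
  have radicand: "0 < s\<^sup>2 - p\<^sup>2"
    using sp by (simp add: power_strict_mono)
  then have r: "0 < r" and r2: "r\<^sup>2 = s\<^sup>2 - p\<^sup>2"
    by (simp_all add: r_def)
  have D: "0 < 1 + 2 * lam * u + lam\<^sup>2 * p\<^sup>2"
    using mmbi_radicand_pos[OF assms(1) sp] by (simp add: u_def r_def)
  then have E: "0 < E" and E2: "E\<^sup>2 = 1 + 2 * lam * u + lam\<^sup>2 * p\<^sup>2"
    by (simp_all add: E_def)
  note derivs = mmbi_derivatives[OF assms(1) sp, of \<gamma>, folded r_def, folded u_def, folded E_def,
      folded hs_def hp_def]
  \<comment> \<open>Solving the definition of the Hamiltonian for \<open>E\<close> makes later steps
    polynomial in \<open>h0\<close>.\<close>
  have h: "E = 1 + lam * h0"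
    using assms(1) by (simp add: h0_def mmbi_def E_def u_def r_def)
  have Ex: "E * x = u + lam * p\<^sup>2"
  proof -
    have "E * x = s * (cosh \<gamma> - sinh \<gamma> * s / r) + p * (sinh \<gamma> * p / r + lam * p)"
      using E by (simp add: x_def hs_def hp_def field_simps)
    also have "\<dots> = s * cosh \<gamma> - sinh \<gamma> * ((s\<^sup>2 - p\<^sup>2) / r) + lam * p\<^sup>2"
      using r by (simp add: field_simps power2_eq_square)
    also have "(s\<^sup>2 - p\<^sup>2) / r = r"
      using r r2[symmetric] by (simp add: power2_eq_square)
    finally show ?thesis by (simp add: u_def)
  qed
  have Ey: "E * y = cosh \<gamma> * r - sinh \<gamma> * s"
    using E r by (simp add: y_def hs_def field_simps)
  \<comment> \<open>The pair (\<open>u\<close>, \<open>E * y\<close>) is (\<open>s\<close>,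
    \<open>r\<close>) boosted by rapidity minus gamma, so u^2 - (E y)^2 = s^2 - r^2 = p^2. The
    formulas for \<open>E * x\<close> and the square of \<open>E\<close> then turn u^2 - p^2 into
    E^2 (x^2 - p^2).\<close>
  have y2: "y\<^sup>2 = x\<^sup>2 - p\<^sup>2"
  proof -
    have "E\<^sup>2 * y\<^sup>2 = (cosh \<gamma> * r - sinh \<gamma> * s)\<^sup>2"
      by (simp add: Ey flip: power_mult_distrib)
    also have "\<dots> = u\<^sup>2 - p\<^sup>2"
      using r2 cosh_square_eq[of \<gamma>] unfolding u_def by algebra
    also have "\<dots> = (E * x)\<^sup>2 - E\<^sup>2 * p\<^sup>2"
      unfolding Ex E2 by algebra
    finally have "E\<^sup>2 * y\<^sup>2 = E\<^sup>2 * (x\<^sup>2 - p\<^sup>2)"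
      by (simp add: algebra_simps power_mult_distrib)
    then show ?thesis using E by simp
  qed
  note invariants = em_tensor_invariants[OF assms(3,5) derivs(1)[unfolded s_def p_def],
      folded s_def p_def, folded h0_def x_def]
  have tr: "tensor_trace (em_tensor (mmbi \<gamma> lam) B) = 6 * (x - h0)"
    by (rule invariants)
  have "4 * hs\<^sup>2 * (s\<^sup>2 - p\<^sup>2) = 4 * y\<^sup>2"
    by (simp add: y_def r2 power_mult_distrib)
  with invariants(2) have sq: "tensor_square (em_tensor (mmbi \<gamma> lam) B) =
      6 * h0\<^sup>2 - 12 * h0 * x + 12 * x\<^sup>2 - 6 * p\<^sup>2"
    unfolding y2 by (simp add: s_def p_def algebra_simps)
  have "(u + lam * p\<^sup>2) / (lam * E) - (E - 1) / lam\<^sup>2 = (x - h0) / lam"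
  proof -
    have "(u + lam * p\<^sup>2) / (lam * E) = x / lam"
      unfolding Ex[symmetric] using E by simp
    moreover have "(E - 1) / lam\<^sup>2 = h0 / lam"
      using assms(1) by (simp add: h power2_eq_square)
    ultimately show ?thesis by (simp add: diff_divide_distrib)
  qed
  also have "\<dots> = (h0\<^sup>2 - 2 * h0 * x + p\<^sup>2) / 2"
  proof -
    \<comment> \<open>Eliminating \<open>u\<close> between \<open>E2\<close> and \<open>Ex\<close>
      gives E^2 = 1 + 2 lam E x - lam^2 p^2; substituting \<open>E = 1 + lam * h0\<close> yields
      this relation.\<close>
    have "lam * (2 * x - 2 * h0) = lam * (lam * (h0\<^sup>2 - 2 * h0 * x + p\<^sup>2))"
      using E2 Ex unfolding h by algebra
    then have "2 * x - 2 * h0 = lam * (h0\<^sup>2 - 2 * h0 * x + p\<^sup>2)"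
      using assms(1) by simp
    then show ?thesis
      using assms(1) by (simp add: field_simps)
  qed
  also have "\<dots> = - O_T2 (em_tensor (mmbi \<gamma> lam) B)"
    unfolding O_T2_def tr sq by (simp add: field_simps power2_eq_square)
  finally have flow_lam: "(u + lam * p\<^sup>2) / (lam * E) - (E - 1) / lam\<^sup>2 =
      - O_T2 (em_tensor (mmbi \<gamma> lam) B)" .
  \<comment> \<open>This fixes the branch: the root in \<open>R_op\<close> returns |y|, and the
    gamma derivative is minus y itself.\<close>
  have "hs \<ge> 0"
    using assms(6) DERIV_imp_deriv[OF derivs(2)] by (simp add: s_def p_def)
  then have y0: "y \<ge> 0"
    using r by (simp add: y_def)
  have "1/6 * (tensor_square (em_tensor (mmbi \<gamma> lam) B)
      - 1/6 * (tensor_trace (em_tensor (mmbi \<gamma> lam) B))\<^sup>2) = y\<^sup>2"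
    unfolding tr sq y2 by (simp add: algebra_simps power2_eq_square)
  then have "R_op (em_tensor (mmbi \<gamma> lam) B) = y"
    using y0 by (simp add: R_op_def)
  also have "y = - ((s * sinh \<gamma> - cosh \<gamma> * r) / E)"
    using E Ey by (simp add: field_simps)
  finally have flow_gamma: "(s * sinh \<gamma> - cosh \<gamma> * r) / E = - R_op (em_tensor (mmbi \<gamma> lam) B)"
    by simp
  show ?thesis
    using derivs(3,4) unfolding flow_lam flow_gamma unfolding s_def p_def by blast
qed

end
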